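(* Let $Y$ be a uniformly convex Banach space over $\mathbb{K}$, where $\mathbb{K}=\mathbb{R}$ or $\mathbb{C}$, and let $c_0\left(\bigoplus_{k=1}^{\infty}\ell_2^k\right)$ be the $c_0$-sum over $\mathbb{K}$ of the Euclidean spaces $\ell_2^k$, $k\in\mathbb{N}$. Then the pair $\left(c_0\left(\bigoplus_{k=1}^{\infty}\ell_2^k\right),Y\right)$ has the Bishop-Phelps-Bollobás property for operators.
   Context: All Banach spaces are over the same scalar field $\mathbb{K}$ ($\mathbb{R}$ or $\mathbb{C}$). For Banach spaces $X,Y$: $S_X$ and $B_X$ are the unit sphere and closed unit ball of $X$, and $\mathcal{L}(X,Y)$ is the space of bounded linear operators from $X$ to $Y$ with the operator norm. $\ell_2^k$ is $\mathbb{K}^k$ with the Euclidean norm $\|\cdot\|_2$. The space $c_0\left(\bigoplus_{k=1}^{\infty}\ell_2^k\right)$ consists of all sequences $(x^{(k)})_{k\ge 1}$ with $x^{(k)}\in\ell_2^k$ and $\|x^{(k)}\|_2\to 0$, with norm $\sup_k\|x^{(k)}\|_2$. Bishop-Phelps-Bollobás property for operators (BPBp): the pair $(X,Y)$ has it if for each $\varepsilon>0$ there are $\eta(\varepsilon)>0$ and $\beta(\varepsilon)>0$, with $\lim_{t\to 0}\beta(t)=0$, such that for all $T\in S_{\mathcal{L}(X,Y)}$ and all $x_0\in S_X$ with $\|Tx_0\|>1-\eta(\varepsilon)$ there exist $u_0\in S_X$ and $S\in S_{\mathcal{L}(X,Y)}$ satisfying $\|Su_0\|=1$, $\|u_0-x_0\|<\beta(\varepsilon)$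 and $\|S-T\|<\varepsilon$. A Banach space $Y$ is uniformly convex if for every $\varepsilon>0$ there is $0<\delta<1$ such that for all $x,y\in B_Y$ with $\left\|\frac{x+y}{2}\right\|>1-\delta$ one has $\|x-y\|<\varepsilon$. *)

theory Defs
  imports "HOL-Analysis.Analysis"
begin

text \<open>A Banach space over a scalar field that is an extension of the reals (below: the reals or the
  complex numbers) is a real Banach space, given as a type of class \<open>banach\<close>, together with a scalar
  multiplication that extends the real one and for which the norm is homogeneous.\<close>

locale banach_space_over = vector_space scale
  for scale :: "'k::real_normed_field \<Rightarrow> 'a::banach \<Rightarrow> 'a" +
  assumes scale_of_real: "scale (of_real r) x = r *\<^sub>R x"
    and norm_scale: "norm (scale c x) = norm c * norm x"

definition uniformly_convex :: "'a::real_normed_vector itself \<Rightarrow> bool" where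
  "uniformly_convex _ \<longleftrightarrow>
    (\<forall>\<epsilon>>0. \<exists>\<delta>. 0 < \<delta> \<and> \<delta> < 1 \<and>
      (\<forall>x y :: 'a. norm x \<le> 1 \<longrightarrow> norm y \<le> 1 \<longrightarrow>
         norm ((1/2) *\<^sub>R (x + y)) > 1 - \<delta> \<longrightarrow> norm (x - y) < \<epsilon>))"

text \<open>Elements of \<open>'x \<Rightarrow>\<^sub>L 'y\<close> are only real-linear; the bounded operators over the scalar field are
  those that also commute with its scalar multiplications. Their norm in \<open>'x \<Rightarrow>\<^sub>L 'y\<close> is the usual
  operator norm.\<close>

definition operators ::
    "('k \<Rightarrow> 'x::real_normed_vector \<Rightarrow> 'x) \<Rightarrow> ('k \<Rightarrow> 'y::real_normed_vector \<Rightarrow> 'y) \<Rightarrow> ('x \<Rightarrow>\<^sub>L 'y) set"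
  where
  "operators scaleX scaleY =
    {T. \<forall>c x. blinfun_apply T (scaleX c x) = scaleY c (blinfun_apply T x)}"

definition BPBp ::
    "('k \<Rightarrow> 'x::real_normed_vector \<Rightarrow> 'x) \<Rightarrow> ('k \<Rightarrow> 'y::real_normed_vector \<Rightarrow> 'y) \<Rightarrow> bool" where
  "BPBp scaleX scaleY \<longleftrightarrow>
    (\<exists>\<eta> \<beta> :: real \<Rightarrow> real.
       (\<forall>\<epsilon>>0. \<eta> \<epsilon> > 0 \<and> \<beta> \<epsilon> > 0) \<and> (\<beta> \<longlongrightarrow> 0) (at_right 0) \<and>
       (\<forall>\<epsilon>>0. \<forall>T \<in> operators scaleX scaleY. \<forall>x0. norm T = 1 \<longrightarrow> norm x0 = 1 \<longrightarrow>
          norm (blinfun_apply T x0) > 1 - \<eta> \<epsilon> \<longrightarrow>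
          (\<exists>u0. \<exists>S \<in> operators scaleX scaleY. norm u0 = 1 \<and> norm S = 1 \<and>
             norm (blinfun_apply S u0) = 1 \<and> norm (u0 - x0) < \<beta> \<epsilon> \<and> norm (S - T) < \<epsilon>)))"

text \<open>The Euclidean space of dimension \<open>n\<close> consists of the sequences supported on \<open>{..<n}\<close>.\<close>

definition ell2_space :: "nat \<Rightarrow> (nat \<Rightarrow> 'k::real_normed_field) set" where
  "ell2_space n = {v. \<forall>i\<ge>n. v i = 0}"

definition ell2_norm :: "nat \<Rightarrow> (nat \<Rightarrow> 'k::real_normed_field) \<Rightarrow> real" where
  "ell2_norm n v = L2_set (\<lambda>i. norm (v i)) {..<n}"

lemma ell2_norm_nonneg [simp]: "0 \<le> ell2_norm n v"
  by (simp add: ell2_norm_def)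

lemma ell2_norm_zero [simp]: "ell2_norm n (\<lambda>i. 0) = 0"
  by (simp add: ell2_norm_def L2_set_def)

lemma ell2_norm_scale: "ell2_norm n (\<lambda>i. c * v i) = norm c * ell2_norm n v"
  by (simp add: ell2_norm_def norm_mult L2_set_right_distrib)

lemma ell2_norm_triangle: "ell2_norm n (\<lambda>i. v i + w i) \<le> ell2_norm n v + ell2_norm n w"
proof -
  have "ell2_norm n (\<lambda>i. v i + w i) \<le> L2_set (\<lambda>i. norm (v i) + norm (w i)) {..<n}"
    unfolding ell2_norm_def by (intro L2_set_mono norm_triangle_ineq) auto
  also have "\<dots> \<le> ell2_norm n v + ell2_norm n w"
    unfolding ell2_norm_def by (rule L2_set_triangle_ineq)
  finally show ?thesis .
qed

lemma norm_le_ell2_norm: "i < n \<Longrightarrow> norm (v i) \<le> ell2_norm n v"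
  unfolding ell2_norm_def by (rule member_le_L2_set) auto

text \<open>The \<open>c\<^sub>0\<close>-sum: since \<open>nat\<close> starts at \<open>0\<close>, the block with index \<open>k\<close> is the Euclidean space of
  dimension \<open>Suc k\<close>.\<close>

typedef (overloaded) 'k c0_ell2 =
  "{x :: nat \<Rightarrow> nat \<Rightarrow> 'k::real_normed_field.
      (\<forall>k. x k \<in> ell2_space (Suc k)) \<and> (\<lambda>k. ell2_norm (Suc k) (x k)) \<longlonglongrightarrow> 0}"
  morphisms block Abs_c0_ell2
  by (rule exI[of _ "\<lambda>k i. 0"]) (simp add: ell2_space_def)

setup_lifting type_definition_c0_ell2

lemma block_add_closed:
  assumes "(\<forall>k. x k \<in> ell2_space (Suc k)) \<and> (\<lambda>k. ell2_norm (Suc k) (x k)) \<longlonglongrightarrow> 0"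
    and "(\<forall>k. y k \<in> ell2_space (Suc k)) \<and> (\<lambda>k. ell2_norm (Suc k) (y k)) \<longlonglongrightarrow> 0"
  shows "(\<forall>k. (\<lambda>i. x k i + y k i) \<in> ell2_space (Suc k)) \<and>
    (\<lambda>k. ell2_norm (Suc k) (\<lambda>i. x k i + y k i)) \<longlonglongrightarrow> 0"
proof -
  have "(\<lambda>k. ell2_norm (Suc k) (x k) + ell2_norm (Suc k) (y k)) \<longlonglongrightarrow> 0"
    using tendsto_add[of "\<lambda>k. ell2_norm (Suc k) (x k)" 0 _ "\<lambda>k. ell2_norm (Suc k) (y k)" 0] assms
    by simp
  then have "(\<lambda>k. ell2_norm (Suc k) (\<lambda>i. x k i + y k i)) \<longlonglongrightarrow> 0"
    by (rule Lim_null_comparison[rotated]) (simp add: ell2_norm_triangle)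
  then show ?thesis
    using assms by (simp add: ell2_space_def)
qed

lemma block_scale_closed:
  assumes "(\<forall>k. x k \<in> ell2_space (Suc k)) \<and> (\<lambda>k. ell2_norm (Suc k) (x k)) \<longlonglongrightarrow> 0"
  shows "(\<forall>k. (\<lambda>i. c * x k i) \<in> ell2_space (Suc k)) \<and>
    (\<lambda>k. ell2_norm (Suc k) (\<lambda>i. c * x k i)) \<longlonglongrightarrow> 0"
  using assms by (auto simp: ell2_space_def ell2_norm_scale intro!: tendsto_mult_right_zero)

lift_definition c0_scale :: "'k::real_normed_field \<Rightarrow> 'k c0_ell2 \<Rightarrow> 'k c0_ell2"
  is "\<lambda>c x k i. c * x k i"
  by (rule block_scale_closed)

instantiation c0_ell2 :: (real_normed_field) real_normed_vector
begin

lift_definition zero_c0_ell2 :: "'a c0_ell2" is "\<lambda>k i. 0"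
  by (simp add: ell2_space_def)

lift_definition plus_c0_ell2 :: "'a c0_ell2 \<Rightarrow> 'a c0_ell2 \<Rightarrow> 'a c0_ell2"
  is "\<lambda>x y k i. x k i + y k i"
  by (rule block_add_closed)

lift_definition uminus_c0_ell2 :: "'a c0_ell2 \<Rightarrow> 'a c0_ell2" is "\<lambda>x k i. - x k i"
  subgoal for x using block_scale_closed[of x "-1"] by simp
  done

definition minus_c0_ell2 :: "'a c0_ell2 \<Rightarrow> 'a c0_ell2 \<Rightarrow> 'a c0_ell2"
  where "minus_c0_ell2 x y = x + - y"

definition scaleR_c0_ell2 :: "real \<Rightarrow> 'a c0_ell2 \<Rightarrow> 'a c0_ell2"
  where "scaleR_c0_ell2 r x = c0_scale (of_real r) x"

definition norm_c0_ell2 :: "'a c0_ell2 \<Rightarrow> real"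
  where "norm_c0_ell2 x = (SUP k. ell2_norm (Suc k) (block x k))"

definition dist_c0_ell2 :: "'a c0_ell2 \<Rightarrow> 'a c0_ell2 \<Rightarrow> real"
  where "dist_c0_ell2 x y = norm (x - y)"

definition sgn_c0_ell2 :: "'a c0_ell2 \<Rightarrow> 'a c0_ell2"
  where "sgn_c0_ell2 x = inverse (norm x) *\<^sub>R x"

definition uniformity_c0_ell2 :: "('a c0_ell2 \<times> 'a c0_ell2) filter"
  where "uniformity_c0_ell2 = (INF e\<in>{0<..}. principal {(x, y). dist x y < e})"

definition open_c0_ell2 :: "'a c0_ell2 set \<Rightarrow> bool"
  where "open_c0_ell2 U = (\<forall>x\<in>U. \<forall>\<^sub>F (x', y) in uniformity. x' = x \<longrightarrow> y \<in> U)"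

lemma block_simps:
  "block 0 = (\<lambda>k i. 0)"
  "block (x + y) = (\<lambda>k i. block x k i + block y k i)"
  "block (x - y) = (\<lambda>k i. block x k i - block y k i)"
  "block (c0_scale c x) = (\<lambda>k i. c * block x k i)"
  "block (r *\<^sub>R x) = (\<lambda>k i. r *\<^sub>R block x k i)"
  for x y :: "'a c0_ell2"
  by (simp_all add: zero_c0_ell2.rep_eq plus_c0_ell2.rep_eq uminus_c0_ell2.rep_eq
      minus_c0_ell2_def c0_scale.rep_eq scaleR_c0_ell2_def scaleR_conv_of_real)

lemma bdd_above_block: "bdd_above (range (\<lambda>k. ell2_norm (Suc k) (block x k)))"
  for x :: "'a c0_ell2"
proof -
  have "(\<lambda>k. ell2_norm (Suc k) (block x k)) \<longlonglongrightarrow> 0"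
    using block[of x] by simp
  then have "Bseq (\<lambda>k. ell2_norm (Suc k) (block x k))"
    by (intro convergent_imp_Bseq) (auto simp: convergent_def)
  then show ?thesis
    by (auto simp: Bseq_def bdd_above_def abs_le_iff)
qed

lemma ell2_norm_block_le: "ell2_norm (Suc k) (block x k) \<le> norm x" for x :: "'a c0_ell2"
  unfolding norm_c0_ell2_def by (rule cSUP_upper[OF _ bdd_above_block]) simp

lemma norm_c0_ell2_le: "(\<And>k. ell2_norm (Suc k) (block x k) \<le> B) \<Longrightarrow> norm x \<le> B"
  for x :: "'a c0_ell2"
  unfolding norm_c0_ell2_def by (rule cSUP_least) auto

lemma block_eq_0: "i \<ge> Suc k \<Longrightarrow> block x k i = 0" for x :: "'a c0_ell2"
  using block[of x] by (auto simp: ell2_space_def)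

lemma norm_block_le: "norm (block x k i) \<le> norm x" for x :: "'a c0_ell2"
proof (cases "i < Suc k")
  case True
  then show ?thesis
    using norm_le_ell2_norm[OF True, of "block x k"] ell2_norm_block_le[of k x] by linarith
next
  case False
  then show ?thesis
    using ell2_norm_block_le[of k x] ell2_norm_nonneg[of "Suc k" "block x k"]
    by (simp add: block_eq_0 del: ell2_norm_nonneg)
qed

lemma norm_c0_scale: "norm (c0_scale c x) = norm c * norm x" for x :: "'a c0_ell2"
proof (rule antisym)
  have le: "norm (c0_scale c x) \<le> norm c * norm x" for c and x :: "'a c0_ell2"
    by (rule norm_c0_ell2_le)
      (simp add: block_simps ell2_norm_scale mult_left_mono ell2_norm_block_le)
  show "norm (c0_scale c x) \<le> norm c * norm x"
    by (rule le)
  show "norm c * norm x \<le> norm (c0_scale c x)"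
  proof (cases "c = 0")
    case True
    then show ?thesis
      using ell2_norm_block_le[of 0 "c0_scale c x"] ell2_norm_nonneg
      by (metis mult_zero_left norm_zero order_trans)
  next
    case False
    then have "c0_scale (inverse c) (c0_scale c x) = x"
      by (simp add: block_inject[symmetric] block_simps mult.assoc[symmetric])
    then have "norm x \<le> norm (inverse c) * norm (c0_scale c x)"
      using le[of "inverse c" "c0_scale c x"] by simp
    then show ?thesis
      using False by (simp add: norm_inverse norm_divide field_simps)
  qed
qed

instance
proof
  fix x y z :: "'a c0_ell2" and a b :: real
  show "x + y + z = x + (y + z)" "x + y = y + x" "0 + x = x" "- x + x = 0"
    by (simp_all add: block_inject[symmetric] block_simps uminus_c0_ell2.rep_eq algebra_simps)
  show "x - y = x + - y"
    by (rule minus_c0_ell2_def)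
  show "a *\<^sub>R (x + y) = a *\<^sub>R x + a *\<^sub>R y" "(a + b) *\<^sub>R x = a *\<^sub>R x + b *\<^sub>R x"
    "a *\<^sub>R b *\<^sub>R x = (a * b) *\<^sub>R x" "1 *\<^sub>R x = x"
    by (simp_all add: block_inject[symmetric] block_simps algebra_simps)
  show "dist x y = norm (x - y)"
    by (rule dist_c0_ell2_def)
  show "sgn x = inverse (norm x) *\<^sub>R x"
    by (rule sgn_c0_ell2_def)
  show "uniformity = (INF e\<in>{0<..}. principal {(x, y :: 'a c0_ell2). dist x y < e})"
    by (rule uniformity_c0_ell2_def)
  show "open U = (\<forall>x\<in>U. \<forall>\<^sub>F (x', y) in uniformity. x' = x \<longrightarrow> y \<in> U)" for U :: "'a c0_ell2 set"
    by (rule open_c0_ell2_def)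
  show "norm (a *\<^sub>R x) = \<bar>a\<bar> * norm x"
    by (simp add: scaleR_c0_ell2_def norm_c0_scale)
  show "norm (x + y) \<le> norm x + norm y"
  proof (rule norm_c0_ell2_le)
    fix k
    have "ell2_norm (Suc k) (block (x + y) k)
        \<le> ell2_norm (Suc k) (block x k) + ell2_norm (Suc k) (block y k)"
      by (simp add: block_simps ell2_norm_triangle)
    also have "\<dots> \<le> norm x + norm y"
      by (intro add_mono ell2_norm_block_le)
    finally show "ell2_norm (Suc k) (block (x + y) k) \<le> norm x + norm y" .
  qed
  show "norm x = 0 \<longleftrightarrow> x = 0"
  proof
    assume "norm x = 0"
    then have "block x k i = 0" for k i
      using norm_block_le[of x k i] by simp
    then show "x = 0"
      by (auto simp: block_inject[symmetric] block_simps)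
  next
    assume "x = 0"
    then show "norm x = 0"
      by (simp add: norm_c0_ell2_def block_simps)
  qed
qed

end

instance c0_ell2 :: ("{real_normed_field, banach}") banach
proof
  fix X :: "nat \<Rightarrow> 'a c0_ell2"
  assume X: "Cauchy X"
  define Y where "Y k i = lim (\<lambda>n. block (X n) k i)" for k i
  have lim: "(\<lambda>n. block (X n) k i) \<longlonglongrightarrow> Y k i" for k i
  proof -
    have "Cauchy (\<lambda>n. block (X n) k i)"
    proof (rule CauchyI)
      fix e :: real assume "e > 0"
      then obtain N where N: "\<And>m n. m \<ge> N \<Longrightarrow> n \<ge> N \<Longrightarrow> norm (X m - X n) < e"
        using CauchyD[OF X] by blast
      show "\<exists>N. \<forall>m\<ge>N. \<forall>n\<ge>N. norm (block (X m) k i - block (X n) k i) < e"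
      proof (intro exI allI impI)
        fix m n assume "m \<ge> N" "n \<ge> N"
        then show "norm (block (X m) k i - block (X n) k i) < e"
          using norm_block_le[of "X m - X n" k i] N[of m n] by (simp add: block_simps)
      qed
    qed
    then show ?thesis
      unfolding Y_def by (simp add: Cauchy_convergent_iff convergent_LIMSEQ_iff)
  qed
  have unif: "\<exists>N. \<forall>n\<ge>N. \<forall>k. ell2_norm (Suc k) (\<lambda>i. block (X n) k i - Y k i) \<le> e"
    if "e > 0" for e :: real
  proof -
    obtain N where N: "\<And>m n. m \<ge> N \<Longrightarrow> n \<ge> N \<Longrightarrow> norm (X m - X n) < e"
      using CauchyD[OF X \<open>e > 0\<close>] by blast
    show ?thesis
    proof (intro exI allI impI)
      fix n k assume n: "n \<ge> N"
      have "(\<lambda>m. ell2_norm (Suc k) (\<lambda>i. block (X n) k i - block (X m) k i))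
          \<longlonglongrightarrow> ell2_norm (Suc k) (\<lambda>i. block (X n) k i - Y k i)"
        unfolding ell2_norm_def L2_set_def by (intro tendsto_intros lim)
      moreover have "ell2_norm (Suc k) (\<lambda>i. block (X n) k i - block (X m) k i) \<le> e"
        if "m \<ge> N" for m
        using ell2_norm_block_le[of k "X n - X m"] N[OF n that] by (simp add: block_simps)
      ultimately show "ell2_norm (Suc k) (\<lambda>i. block (X n) k i - Y k i) \<le> e"
        by (intro Lim_bounded) auto
    qed
  qed
  have "Y k \<in> ell2_space (Suc k)" for k
    using LIMSEQ_unique[OF lim[of k]] by (simp add: ell2_space_def block_eq_0)
  moreover have "(\<lambda>k. ell2_norm (Suc k) (Y k)) \<longlonglongrightarrow> 0"
  proof (rule LIMSEQ_I)
    fix e :: real assume e: "e > 0"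
    obtain N where N: "\<And>k. ell2_norm (Suc k) (\<lambda>i. block (X N) k i - Y k i) \<le> e / 2"
      using unif[of "e / 2"] e by auto
    have "(\<lambda>k. ell2_norm (Suc k) (block (X N) k)) \<longlonglongrightarrow> 0"
      using block[of "X N"] by simp
    from LIMSEQ_D[OF this, of "e / 2"] e obtain K
      where K: "\<And>k. k \<ge> K \<Longrightarrow> ell2_norm (Suc k) (block (X N) k) < e / 2"
      by auto
    have "ell2_norm (Suc k) (Y k) < e" if "k \<ge> K" for k
    proof -
      have "ell2_norm (Suc k) (Y k) = ell2_norm (Suc k)
          (\<lambda>i. block (X N) k i + (- 1) * (block (X N) k i - Y k i))"
        by simp
      also have "\<dots> \<le> ell2_norm (Suc k) (block (X N) k)
          + ell2_norm (Suc k) (\<lambda>i. (- 1) * (block (X N) k i - Y k i))"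
        by (rule ell2_norm_triangle)
      also have "\<dots> < e"
        using N[of k] K[OF that] by (simp only: ell2_norm_scale) simp
      finally show ?thesis .
    qed
    then show "\<exists>K. \<forall>k\<ge>K. norm (ell2_norm (Suc k) (Y k) - 0) < e"
      by auto
  qed
  ultimately obtain L where L: "block L = Y"
    using block_cases[of Y] by auto
  have "X \<longlonglongrightarrow> L"
  proof (rule LIMSEQ_I)
    fix e :: real assume e: "e > 0"
    obtain N where N: "\<And>n k. n \<ge> N \<Longrightarrow> ell2_norm (Suc k) (\<lambda>i. block (X n) k i - Y k i) \<le> e / 2"
      using unif[of "e / 2"] e by auto
    have "norm (X n - L) < e" if "n \<ge> N" for n
    proof -
      have "norm (X n - L) \<le> e / 2"
        by (rule norm_c0_ell2_le) (use N[OF that] L in \<open>simp add: block_simps\<close>)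
      then show ?thesis using e by simp
    qed
    then show "\<exists>N. \<forall>n\<ge>N. norm (X n - L) < e"
      by blast
  qed
  then show "convergent X"
    by (auto simp: convergent_def)
qed

lemma banach_space_over_c0_scale:
  "banach_space_over (c0_scale :: 'k::{real_normed_field, banach} \<Rightarrow> 'k c0_ell2 \<Rightarrow> 'k c0_ell2)"
  by unfold_locales
    (simp_all add: norm_c0_scale scaleR_c0_ell2_def[symmetric] block_inject[symmetric] block_simps
      algebra_simps)

lemma banach_space_over_scaleR: "banach_space_over (scaleR :: real \<Rightarrow> 'a::banach \<Rightarrow> 'a)"
  by unfold_locales (simp_all add: algebra_simps)

end

theory Submission
  imports Defs
begin

text \<open>Let \<open>T\<close> have norm one and nearly attain it at the unit vector \<open>x\<close>. Some block of \<open>x\<close> has norm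
  one, and pairing with it gives a functional \<open>f\<close> of norm one with \<open>f x = 1\<close>. Perturb \<open>T\<close> to
  \<open>V z = T z + \<gamma> f(z) T x\<close> with a small \<open>\<gamma>\<close>. On the unit ball of the space spanned by finitely many
  blocks, \<open>V\<close> attains its maximal norm, by compactness, at some \<open>u\<close>; as \<open>V x\<close> already has norm almost
  \<open>1 + \<gamma>\<close>, a suitable rotation of \<open>u\<close> makes \<open>T ((u + x) / 2)\<close> almost of norm one
  (\<open>exists_maximizing_perturbation\<close>). All estimates are independent of the number of blocks, which is
  what makes \<open>\<eta>\<close> depend on \<open>\<epsilon>\<close> alone.

  Uniform convexity now acts twice. Let \<open>D\<close> be the set of blocks on which \<open>(u + x) / 2\<close> has norm at
  most \<open>1 - \<rho>\<close>. Outside \<open>D\<close>, uniform convexity of the Euclidean norm forces \<open>u\<close> to be close to \<open>x\<close>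
  (\<open>ell2_uniformly_convex\<close>). On \<open>D\<close>, the vector \<open>(u + x) / 2\<close> can be moved by \<open>\<plusminus> \<rho> z\<close> within the unit
  ball, so uniform convexity of the range forces \<open>T\<close> to be small on the span of the blocks in \<open>D\<close>
  (\<open>operator_small_on_slack_blocks\<close>).

  Hence the vector \<open>u'\<close> that equals \<open>u\<close> outside \<open>D\<close> and \<open>x\<close> on \<open>D\<close> is close to \<open>x\<close>. A contraction
  \<open>R\<close> of the domain maps the normalized \<open>u'\<close> to \<open>u\<close> and differs substantially from the identity only
  on \<open>D\<close> (\<open>exists_contraction_onto\<close>). So \<open>V \<circ> R\<close> attains its norm at the normalized \<open>u'\<close>, and it is
  close to \<open>T\<close> because \<open>T\<close> hardly sees \<open>D\<close>. The rescaled operator \<open>V \<circ> R\<close> is the one sought.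

  The argument is uniform in the scalars: it applies to every normed field that is a Euclidean
  space, since then finite-dimensional balls are compact and the parallelogram law holds.\<close>

section \<open>Coordinates of the \<open>c\<^sub>0\<close>-sum\<close>

lift_definition c0_restrict :: "nat set \<Rightarrow> 'k::real_normed_field c0_ell2 \<Rightarrow> 'k c0_ell2"
  is "\<lambda>A x k. if k \<in> A then x k else (\<lambda>i. 0)"
proof (intro conjI allI)
  fix A :: "nat set" and x :: "nat \<Rightarrow> nat \<Rightarrow> 'k" and k
  assume x: "(\<forall>k. x k \<in> ell2_space (Suc k)) \<and> (\<lambda>k. ell2_norm (Suc k) (x k)) \<longlonglongrightarrow> 0"
  then show "(if k \<in> A then x k else (\<lambda>i. 0)) \<in> ell2_space (Suc k)"
    by (simp add: ell2_space_def)
  show "(\<lambda>k. ell2_norm (Suc k) (if k \<in> A then x k else (\<lambda>i. 0))) \<longlonglongrightarrow> 0"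
    by (rule Lim_null_comparison[OF _ conjunct2[OF x]]) simp
qed

lemma block_c0_restrict: "block (c0_restrict A x) k = (if k \<in> A then block x k else (\<lambda>i. 0))"
  by (simp add: c0_restrict.rep_eq)

lemma c0_eqI: "(\<And>k i. block x k i = block y k i) \<Longrightarrow> x = y"
  by (simp add: block_inject[symmetric] fun_eq_iff)

lemma c0_restrict_idem: "c0_restrict A (c0_restrict A x) = c0_restrict A x"
  by (rule c0_eqI) (simp add: block_c0_restrict)

lemma c0_restrict_scale: "c0_restrict A (c0_scale c x) = c0_scale c (c0_restrict A x)"
  by (rule c0_eqI) (simp add: block_c0_restrict block_simps)

lemma norm_c0_restrict_le: "norm (c0_restrict A x) \<le> norm x"
  by (rule norm_c0_ell2_le)
    (simp add: block_c0_restrict ell2_norm_block_le order_trans[OF ell2_norm_nonneg ell2_norm_block_le])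

lemma bounded_linear_c0_restrict: "bounded_linear (c0_restrict A)"
  by (rule bounded_linear_intro[of _ 1])
    (auto intro!: c0_eqI simp: block_c0_restrict block_simps norm_c0_restrict_le)

lemma ell2_norm_block_tendsto_0: "(\<lambda>k. ell2_norm (Suc k) (block x k)) \<longlonglongrightarrow> 0"
  using block[of x] by simp

lemma c0_norm_attained: "\<exists>j. ell2_norm (Suc j) (block x j) = norm x"
proof (cases "x = 0")
  case True
  then show ?thesis by (simp add: block_simps)
next
  case False
  let ?a = "\<lambda>k. ell2_norm (Suc k) (block x k)"
  have "\<forall>\<^sub>F k in sequentially. ?a k < norm x / 2"
    using False by (intro order_tendstoD(2)[OF ell2_norm_block_tendsto_0]) simp
  then obtain N where N: "\<And>k. k \<ge> N \<Longrightarrow> ?a k < norm x / 2"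
    by (auto simp: eventually_sequentially)
  define m where "m = Max (insert 0 (?a ` {..<N}))"
  have "?a k \<le> max m (norm x / 2)" for k
  proof (cases "k < N")
    case True
    then have "?a k \<le> m" unfolding m_def by (intro Max_ge) auto
    then show ?thesis by simp
  qed (use N[of k] in simp)
  then have "norm x \<le> max m (norm x / 2)" by (rule norm_c0_ell2_le)
  with False have m: "norm x \<le> m" by (auto simp: max_def split: if_splits)
  have "m \<in> insert 0 (?a ` {..<N})" unfolding m_def by (rule Max_in) auto
  with m False obtain j where "m = ?a j" by auto
  with m ell2_norm_block_le[of j x] show ?thesis by (auto intro!: exI[of _ j])
qed

lemma c0_tail_small:
  assumes "\<eta> > 0"
  shows "\<exists>N. norm (x - c0_restrict {..<N} x) \<le> \<eta>"
proof -
  obtain N where N: "\<And>k. k \<ge> N \<Longrightarrow> ell2_norm (Suc k) (block x k) < \<eta>"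
    using order_tendstoD(2)[OF ell2_norm_block_tendsto_0 assms]
    by (auto simp: eventually_sequentially)
  have "norm (x - c0_restrict {..<N} x) \<le> \<eta>"
  proof (rule norm_c0_ell2_le)
    fix k show "ell2_norm (Suc k) (block (x - c0_restrict {..<N} x) k) \<le> \<eta>"
      using N[of k] assms by (cases "k < N") (simp_all add: block_simps block_c0_restrict)
  qed
  then show ?thesis by blast
qed

section \<open>Compactness of finite-dimensional balls\<close>

text \<open>The coordinates of block \<open>k\<close> end at \<open>k\<close>, so for \<open>i > k\<close> the value is \<open>0\<close>.\<close>

lift_definition c0_unit :: "nat \<Rightarrow> nat \<Rightarrow> 'k::real_normed_field c0_ell2"
  is "\<lambda>k i l m. if l = k \<and> m = i \<and> i \<le> k then 1 else 0"
proof (intro conjI allI)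
  fix k i l :: nat
  show "(\<lambda>m. if l = k \<and> m = i \<and> i \<le> k then 1 else 0 :: 'k) \<in> ell2_space (Suc l)"
    by (auto simp: ell2_space_def)
  have "\<forall>\<^sub>F l in sequentially.
      ell2_norm (Suc l) (\<lambda>m. if l = k \<and> m = i \<and> i \<le> k then 1 else 0 :: 'k) = 0"
    using eventually_gt_at_top[of k] by eventually_elim simp
  then show "(\<lambda>l. ell2_norm (Suc l) (\<lambda>m. if l = k \<and> m = i \<and> i \<le> k then 1 else 0 :: 'k)) \<longlonglongrightarrow> 0"
    by (rule tendsto_eventually)
qed

lemma block_sum: "block (\<Sum>p\<in>F. h p) k i = (\<Sum>p\<in>F. block (h p) k i)"
  by (induction F rule: infinite_finite_induct) (simp_all add: block_simps)

lemma c0_finite_expansion: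
  assumes "c0_restrict {..<N} x = x"
  shows "(\<Sum>p\<in>Sigma {..<N} (\<lambda>k. {..k}). c0_scale (block x (fst p) (snd p)) (c0_unit (fst p) (snd p))) = x"
    (is "(\<Sum>p\<in>?F. _) = x")
proof (rule c0_eqI)
  fix k i
  have "block (\<Sum>p\<in>?F. c0_scale (block x (fst p) (snd p)) (c0_unit (fst p) (snd p))) k i
      = (\<Sum>p\<in>?F. if p = (k, i) then block x k i else 0)"
    unfolding block_sum
    by (rule sum.cong) (auto simp: block_simps c0_unit.rep_eq)
  also have "\<dots> = (if (k, i) \<in> ?F then block x k i else 0)"
    by (rule sum.delta) auto
  also have "\<dots> = block x k i"
  proof (cases "k < N \<and> i \<le> k")
    case False
    then have "block x k i = 0"
      using block_eq_0[of k i x] arg_cong[OF assms, of "\<lambda>y. block y k i"]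
      by (auto simp: block_c0_restrict split: if_splits)
    then show ?thesis by simp
  qed simp
  finally show "block (\<Sum>p\<in>?F. c0_scale (block x (fst p) (snd p)) (c0_unit (fst p) (snd p))) k i
    = block x k i" .
qed

lemma bounded_linear_c0_scale_left: "bounded_linear (\<lambda>c. c0_scale c x)"
  by (rule bounded_linear_intro[of _ "norm x"])
    (auto intro!: c0_eqI simp: block_simps algebra_simps norm_c0_scale)

text \<open>Adding one vector to the family turns the box into the continuous image of a product of the
  former box with a ball of scalars.\<close>

lemma compact_c0_box:
  fixes e :: "'i \<Rightarrow> 'k::{real_normed_field, euclidean_space} c0_ell2"
  assumes "finite F"
  shows "compact {\<Sum>p\<in>F. c0_scale (a p) (e p) | a. \<forall>p\<in>F. norm (a p) \<le> 1}"
  using assms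
proof (induction F rule: finite_induct)
  case (insert q F)
  let ?B = "\<lambda>F. {\<Sum>p\<in>F. c0_scale (a p) (e p) | a. \<forall>p\<in>F. norm (a p) \<le> 1}"
  have "compact ((\<lambda>(c, y). c0_scale c (e q) + y) ` (cball 0 1 \<times> ?B F))"
    unfolding case_prod_unfold
    by (intro compact_continuous_image compact_Times compact_cball insert.IH continuous_intros
        bounded_linear.continuous_on[OF bounded_linear_c0_scale_left])
  also have "(\<lambda>(c, y). c0_scale c (e q) + y) ` (cball 0 1 \<times> ?B F) = ?B (insert q F)"
  proof (intro set_eqI iffI)
    fix z assume "z \<in> (\<lambda>(c, y). c0_scale c (e q) + y) ` (cball 0 1 \<times> ?B F)"
    then obtain c a where c: "norm c \<le> 1" and a: "\<forall>p\<in>F. norm (a p) \<le> 1"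
      and z: "z = c0_scale c (e q) + (\<Sum>p\<in>F. c0_scale (a p) (e p))" by auto
    have "(\<Sum>p\<in>F. c0_scale ((a(q := c)) p) (e p)) = (\<Sum>p\<in>F. c0_scale (a p) (e p))"
      using insert.hyps by (intro sum.cong) auto
    then have "z = (\<Sum>p\<in>insert q F. c0_scale ((a(q := c)) p) (e p))"
      using insert.hyps z by simp
    moreover have "\<forall>p\<in>insert q F. norm ((a(q := c)) p) \<le> 1" using a c by auto
    ultimately show "z \<in> ?B (insert q F)" by blast
  next
    fix z assume "z \<in> ?B (insert q F)"
    then obtain a where a: "\<forall>p\<in>insert q F. norm (a p) \<le> 1"
      and z: "z = (\<Sum>p\<in>insert q F. c0_scale (a p) (e p))" by auto
    have "z = (\<lambda>(c, y). c0_scale c (e q) + y) (a q, \<Sum>p\<in>F. c0_scale (a p) (e p))"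
      using insert.hyps z by simp
    moreover have "(a q, \<Sum>p\<in>F. c0_scale (a p) (e p)) \<in> cball 0 1 \<times> ?B F"
      using a by auto
    ultimately show "z \<in> (\<lambda>(c, y). c0_scale c (e q) + y) ` (cball 0 1 \<times> ?B F)"
      by (rule image_eqI)
  qed
  finally show ?case .
qed simp

text \<open>In terms of the coordinate vectors this ball is a closed subset of a box.\<close>

lemma compact_c0_finite_ball:
  "compact {x :: 'k::{real_normed_field, euclidean_space} c0_ell2.
     norm x \<le> 1 \<and> c0_restrict {..<N} x = x}"
proof -
  let ?F = "Sigma {..<N} (\<lambda>k. {..k})"
  let ?B = "{\<Sum>p\<in>?F. c0_scale (a p) (c0_unit (fst p) (snd p)) :: 'k c0_ell2 | a.
    \<forall>p\<in>?F. norm (a p) \<le> 1}"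
  let ?C = "{x :: 'k c0_ell2. norm x \<le> 1 \<and> c0_restrict {..<N} x = x}"
  have "closed ?C"
    by (intro closed_Collect_conj closed_Collect_le closed_Collect_eq continuous_intros
        linear_continuous_on bounded_linear_c0_restrict)
  moreover have "compact ?B" by (rule compact_c0_box) simp
  ultimately have "compact (?C \<inter> ?B)" by (rule closed_Int_compact)
  moreover have "?C \<subseteq> ?B"
  proof
    fix x assume x: "x \<in> ?C"
    then have "x = (\<Sum>p\<in>?F. c0_scale (block x (fst p) (snd p)) (c0_unit (fst p) (snd p)))"
      using c0_finite_expansion[of N x] by simp
    moreover have "\<forall>p\<in>?F. norm (block x (fst p) (snd p)) \<le> 1"
      using x norm_block_le[of x] by (auto intro: order_trans)
    ultimately show "x \<in> ?B" by (intro CollectI exI[of _ "\<lambda>p. block x (fst p) (snd p)"]) blast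
  qed
  ultimately show ?thesis by (simp add: Int_absorb2)
qed

section \<open>Norming functionals and uniform convexity of the blocks\<close>

text \<open>Since the block norms tend to zero, a single block carries the norm of \<open>x\<close>, and the inner
  product with that block, divided by its norm, is norming by the Cauchy-Schwarz inequality.\<close>

lemma c0_norming_functional:
  fixes x :: "'k::real_normed_field c0_ell2"
  obtains \<phi> where "bounded_linear \<phi>" "\<And>c z. \<phi> (c0_scale c z) = c * \<phi> z"
    "\<And>z. norm (\<phi> z) \<le> norm z" "\<phi> x = of_real (norm x)"
proof -
  obtain j where j: "ell2_norm (Suc j) (block x j) = norm x"
    using c0_norm_attained by blast
  \<comment> \<open>For complex scalars \<open>a i\<close> is the conjugate of \<open>block x j i\<close>; the quotient makes sense in every
    normed field and is \<open>0\<close> where the coordinate vanishes.\<close>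
  define a where "a i = of_real ((norm (block x j i))\<^sup>2) / block x j i" for i
  have a: "norm (a i) = norm (block x j i)" for i
    by (simp add: a_def norm_divide norm_power power2_eq_square del: of_real_power of_real_mult)
  have xa: "block x j i * a i = of_real ((norm (block x j i))\<^sup>2)" for i
    by (simp add: a_def)
  define \<phi> where "\<phi> z = (\<Sum>i<Suc j. block z j i * a i) / of_real (norm x)" for z
  have le: "norm (\<phi> z) \<le> norm z" for z
  proof -
    have "norm (\<Sum>i<Suc j. block z j i * a i) \<le> (\<Sum>i<Suc j. \<bar>norm (block z j i)\<bar> * \<bar>norm (block x j i)\<bar>)"
      by (rule order_trans[OF norm_sum]) (simp add: norm_mult a)
    also have "\<dots> \<le> ell2_norm (Suc j) (block z j) * ell2_norm (Suc j) (block x j)"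
      unfolding ell2_norm_def by (rule L2_set_mult_ineq)
    also have "\<dots> \<le> norm z * norm x"
      unfolding j by (rule mult_right_mono[OF ell2_norm_block_le]) simp
    finally show ?thesis
      by (cases "x = 0") (simp_all add: \<phi>_def norm_divide divide_simps)
  qed
  have hom: "\<phi> (c0_scale c z) = c * \<phi> z" for c z
    by (simp add: \<phi>_def block_simps sum_distrib_left mult.assoc del: sum.lessThan_Suc)
  have add: "\<phi> (y + z) = \<phi> y + \<phi> z" for y z
    by (simp add: \<phi>_def block_simps sum.distrib algebra_simps add_divide_distrib del: sum.lessThan_Suc)
  have "bounded_linear \<phi>"
    by (rule bounded_linear_intro[of _ 1])
      (simp_all add: add hom le scaleR_c0_ell2_def scaleR_conv_of_real)
  moreover have "\<phi> x = of_real (norm x)"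
  proof -
    have "(\<Sum>i<Suc j. (norm (block x j i))\<^sup>2) = (norm x)\<^sup>2"
      by (simp add: j[symmetric] ell2_norm_def L2_set_def sum_nonneg del: sum.lessThan_Suc)
    then have "(\<Sum>i<Suc j. block x j i * a i) = of_real ((norm x)\<^sup>2)"
      unfolding xa of_real_sum[symmetric] by simp
    then show ?thesis
      by (simp add: \<phi>_def power2_eq_square del: sum.lessThan_Suc)
  qed
  ultimately show ?thesis using that hom le by blast
qed

lemma ell2_parallelogram:
  fixes v w :: "nat \<Rightarrow> 'k::{real_normed_field, real_inner}"
  shows "(ell2_norm n (\<lambda>i. v i + w i))\<^sup>2 + (ell2_norm n (\<lambda>i. v i - w i))\<^sup>2
    = 2 * (ell2_norm n v)\<^sup>2 + 2 * (ell2_norm n w)\<^sup>2"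
proof -
  have sq: "(ell2_norm n v)\<^sup>2 = (\<Sum>i<n. (norm (v i))\<^sup>2)" for v :: "nat \<Rightarrow> 'k"
    by (simp add: ell2_norm_def L2_set_def sum_nonneg)
  have "(norm (a + b))\<^sup>2 + (norm (a - b))\<^sup>2 = 2 * (norm a)\<^sup>2 + 2 * (norm b)\<^sup>2" for a b :: 'k
    by (simp add: power2_norm_eq_inner inner_add inner_diff inner_commute)
  then show ?thesis
    by (simp add: sq sum.distrib[symmetric] sum_distrib_left)
qed

lemma ell2_uniformly_convex:
  fixes v w :: "nat \<Rightarrow> 'k::{real_normed_field, real_inner}"
  assumes "ell2_norm n v \<le> 1" "ell2_norm n w \<le> 1" "r \<ge> 0" "r \<le> 1"
    and "ell2_norm n (\<lambda>i. v i + w i) \<ge> 2 * (1 - r\<^sup>2 / 8)"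
  shows "ell2_norm n (\<lambda>i. v i - w i) \<le> r"
proof -
  have "r\<^sup>2 \<le> 1" using assms by (simp add: power_le_one)
  then have "(2 * (1 - r\<^sup>2 / 8))\<^sup>2 \<le> (ell2_norm n (\<lambda>i. v i + w i))\<^sup>2"
    using assms by (intro power_mono) auto
  moreover have "(ell2_norm n v)\<^sup>2 \<le> 1" "(ell2_norm n w)\<^sup>2 \<le> 1"
    using assms by (simp_all add: power_le_one)
  moreover have "(2 * (1 - r\<^sup>2 / 8))\<^sup>2 = 4 - r\<^sup>2 + (r\<^sup>2 / 4)\<^sup>2"
    by (simp add: power2_eq_square algebra_simps)
  moreover have "(r\<^sup>2 / 4)\<^sup>2 \<ge> 0"
    by simp
  ultimately have "(ell2_norm n (\<lambda>i. v i - w i))\<^sup>2 \<le> r\<^sup>2"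
    using ell2_parallelogram[of n v w] by linarith
  then show ?thesis using assms(3) by (rule power2_le_imp_le)
qed


section \<open>Operators into a uniformly convex space\<close>

lemma (in banach_space_over) bounded_linear_scale_left: "bounded_linear (\<lambda>c. scale c y)"
proof (rule bounded_linear_intro[of _ "norm y"])
  fix r c
  have "scale (r *\<^sub>R c) y = scale (of_real r) (scale c y)"
    by (simp add: scaleR_conv_of_real)
  then show "scale (r *\<^sub>R c) y = r *\<^sub>R scale c y"
    by (simp only: scale_of_real)
qed (simp_all add: scale_left_distrib norm_scale)

lemma operatorsD: "T \<in> operators scaleX scaleY \<Longrightarrow> T (scaleX c x) = scaleY c (T x)"
  by (simp add: operators_def)

lemma norm_blinfun_le: "norm T \<le> 1 \<Longrightarrow> norm (blinfun_apply T z) \<le> norm z"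
  using norm_blinfun[of T z] mult_right_mono[of "norm T" 1 "norm z"] by simp

lemma norm_add_diff_le: "norm (p + q - v) \<le> norm p + norm q + norm v"
  for p q v :: "'a::real_normed_vector"
  using norm_triangle_ineq4[of "p + q" v] norm_triangle_ineq[of p q] by linarith

text \<open>The images of \<open>w + t z\<close> and \<open>w - t z\<close> lie in the unit ball and have midpoint \<open>T w\<close>.\<close>

lemma uniformly_convex_image_small:
  fixes T :: "'x::real_normed_vector \<Rightarrow>\<^sub>L 'y::real_normed_vector"
  assumes uc: "\<And>a b :: 'y. norm a \<le> 1 \<Longrightarrow> norm b \<le> 1 \<Longrightarrow>
      norm ((1/2) *\<^sub>R (a + b)) > 1 - \<delta> \<Longrightarrow> norm (a - b) < \<epsilon>"
    and T: "norm T \<le> 1" and t: "t > 0"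
    and w: "norm (w + t *\<^sub>R z) \<le> 1" "norm (w - t *\<^sub>R z) \<le> 1" "norm (T w) > 1 - \<delta>"
  shows "norm (T z) \<le> \<epsilon> / (2 * t)"
proof -
  have "(1/2) *\<^sub>R (T (w + t *\<^sub>R z) + T (w - t *\<^sub>R z)) = T w"
    by (simp add: blinfun.bilinear_simps flip: scaleR_2)
  then have "norm (T (w + t *\<^sub>R z) - T (w - t *\<^sub>R z)) < \<epsilon>"
    using w norm_blinfun_le[OF T] by (intro uc) (auto intro: order_trans)
  moreover have "T (w + t *\<^sub>R z) - T (w - t *\<^sub>R z) = (2 * t) *\<^sub>R T z"
    by (simp add: blinfun.bilinear_simps scaleR_2 flip: scaleR_scaleR)
  ultimately show ?thesis using t by (simp add: field_simps)
qed

text \<open>The rank-one term forces a maximum point \<open>u\<close> of \<open>V\<close> to agree with \<open>x\<close> as seen by \<open>f\<close>: the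
  value \<open>norm (V x)\<close>, nearly \<open>1 + \<gamma>\<close>, is only reached if \<open>norm (T u)\<close> and \<open>norm (f u)\<close> are both
  nearly one. Turning \<open>u\<close> so that \<open>f u\<close> is nonnegative, \<open>T u\<close> and \<open>T x\<close> add up in \<open>V u\<close> without
  cancellation, so that \<open>T (u + x)\<close> has norm nearly two.\<close>

lemma exists_maximizing_perturbation:
  fixes T :: "'k::{real_normed_field, euclidean_space} c0_ell2 \<Rightarrow>\<^sub>L 'y::banach"
  assumes Y: "banach_space_over scaleY" and TO: "T \<in> operators c0_scale scaleY"
    and T: "norm T \<le> 1" and x: "norm x = 1" and \<gamma>: "0 < \<gamma>" "\<gamma> \<le> 1" and \<eta>: "0 < \<eta>"
    and Tx: "norm (T x) > 1 - \<eta>"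
  obtains V u N where "V \<in> operators c0_scale scaleY" "norm (V - T) \<le> \<gamma>"
    "norm u \<le> 1" "c0_restrict {..<N} u = u"
    "\<And>z. norm z \<le> 1 \<Longrightarrow> c0_restrict {..<N} z = z \<Longrightarrow> norm (V z) \<le> norm (V u)"
    "norm (T (u + x)) \<ge> 2 - 8 * \<eta> / \<gamma>"
proof -
  interpret Y: banach_space_over scaleY by (rule Y)
  obtain f :: "'k c0_ell2 \<Rightarrow> 'k" where f: "bounded_linear f" "\<And>c z. f (c0_scale c z) = c * f z"
    "\<And>z. norm (f z) \<le> norm z" "f x = 1"
    using c0_norming_functional[of x] x by auto
  have bl: "bounded_linear (\<lambda>z. scaleY (f z) (T x))"
    using bounded_linear_compose[OF Y.bounded_linear_scale_left f(1)] .
  define E where "E = Blinfun (\<lambda>z. scaleY (f z) (T x))"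
  have E: "blinfun_apply E z = scaleY (f z) (T x)" for z
    unfolding E_def by (simp add: bounded_linear_Blinfun_apply[OF bl])
  have Tx1: "norm (T x) \<le> 1" using norm_blinfun_le[OF T, of x] x by simp
  have Ez: "norm (E z) \<le> norm (f z)" for z
    using mult_left_mono[OF Tx1, of "norm (f z)"] by (simp add: E Y.norm_scale)
  have E1: "norm E \<le> 1"
    by (rule norm_blinfun_bound) (use order_trans[OF Ez f(3)] in auto)
  define V where "V = T + \<gamma> *\<^sub>R E"
  have Vz: "blinfun_apply V z = T z + \<gamma> *\<^sub>R E z" for z
    by (simp add: V_def blinfun.bilinear_simps)
  have VO: "V \<in> operators c0_scale scaleY"
    unfolding operators_def
    by (auto simp: Vz E operatorsD[OF TO] f(2) Y.scale_right_distrib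
        Y.scale_of_real[symmetric] mult.commute)
  have VT: "norm (V - T) \<le> \<gamma>"
    using \<gamma> E1 by (simp add: V_def mult_left_le)
  have V2: "norm V \<le> 1 + \<gamma>"
    using norm_triangle_ineq[of T "V - T"] VT T by simp
  obtain N where N: "norm (x - c0_restrict {..<N} x) \<le> \<eta>"
    using c0_tail_small[OF \<eta>] by blast
  let ?C = "{z :: 'k c0_ell2. norm z \<le> 1 \<and> c0_restrict {..<N} z = z}"
  have PxC: "c0_restrict {..<N} x \<in> ?C"
    using norm_c0_restrict_le[of "{..<N}" x] x by (simp add: c0_restrict_idem)
  have "continuous_on ?C (\<lambda>z. norm (V z))" by (intro continuous_intros)
  then obtain v where v: "v \<in> ?C" and vmax: "\<And>z. z \<in> ?C \<Longrightarrow> norm (V z) \<le> norm (V v)"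
    using continuous_attains_sup[OF compact_c0_finite_ball[of N], of "\<lambda>z. norm (V z)"] PxC
    by blast
  \<comment> \<open>The maximum point is determined up to a unimodular scalar only, which is fixed by \<open>f u \<ge> 0\<close>.\<close>
  define c where "c = (if f v = 0 then 1 else of_real (norm (f v)) / f v)"
  define u where "u = c0_scale c v"
  have c: "norm c = 1" by (simp add: c_def norm_divide)
  have fu: "f u = of_real (norm (f v))" by (simp add: u_def f(2) c_def)
  have uC: "u \<in> ?C" using v by (simp add: u_def norm_c0_scale c c0_restrict_scale)
  have Vu: "norm (V u) = norm (V v)"
    by (simp add: u_def operatorsD[OF VO] Y.norm_scale c)
  define a where "a = norm (f v)"
  have Eu: "E u = a *\<^sub>R T x" by (simp add: E fu a_def Y.scale_of_real)
  have a: "0 \<le> a" "a \<le> 1" using f(3)[of v] v by (auto simp: a_def)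
  have lower: "norm (V u) \<ge> 1 + \<gamma> - 4 * \<eta>"
  proof -
    have "V x = (1 + \<gamma>) *\<^sub>R T x"
      using Y.scale_of_real[of 1] by (simp add: Vz E f(4) scaleR_add_left)
    then have "norm (V x) = (1 + \<gamma>) * norm (T x)" using \<gamma> by simp
    also have "\<dots> \<ge> (1 + \<gamma>) * (1 - \<eta>)" using Tx \<gamma> by (intro mult_left_mono) auto
    finally have 1: "norm (V x) \<ge> (1 + \<gamma>) * (1 - \<eta>)" .
    have "norm (V (x - c0_restrict {..<N} x)) \<le> (1 + \<gamma>) * \<eta>"
      by (rule order_trans[OF norm_blinfun mult_mono]) (use V2 N \<gamma> in auto)
    then have "norm (V x) \<le> norm (V (c0_restrict {..<N} x)) + (1 + \<gamma>) * \<eta>"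
      using norm_triangle_ineq[of "V (c0_restrict {..<N} x)" "V (x - c0_restrict {..<N} x)"]
      by (simp add: blinfun.bilinear_simps)
    moreover have "\<gamma> * \<eta> \<le> \<eta>" using \<gamma> \<eta> by simp
    moreover have "norm (V (c0_restrict {..<N} x)) \<le> norm (V u)"
      using vmax[OF PxC] Vu by simp
    ultimately show ?thesis using 1 by (simp add: algebra_simps)
  qed
  have Tu: "norm (T u) \<le> 1" using norm_blinfun_le[OF T, of u] uC by simp
  have VuE: "V u = T u + (\<gamma> * a) *\<^sub>R T x" by (simp add: Vz Eu)
  have aTx: "a * norm (T x) \<le> a" using a Tx1 by (simp add: mult_left_le)
  have "norm (V u) \<le> 1 + \<gamma> * a"
  proof -
    have "norm (V u) \<le> norm (T u) + \<gamma> * (a * norm (T x))"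
      unfolding VuE by (rule order_trans[OF norm_triangle_ineq]) (use \<gamma> a in simp)
    also have "\<dots> \<le> 1 + \<gamma> * a"
      using Tu aTx \<gamma> by (intro add_mono mult_left_mono) auto
    finally show ?thesis .
  qed
  with lower have a4: "\<gamma> * (1 - a) \<le> 4 * \<eta>" by (simp add: algebra_simps)
  have "V u = \<gamma> *\<^sub>R T (u + x) + (1 - \<gamma>) *\<^sub>R T u - (\<gamma> * (1 - a)) *\<^sub>R T x"
    by (simp add: VuE blinfun.bilinear_simps algebra_simps)
  then have "norm (V u) \<le> norm (\<gamma> *\<^sub>R T (u + x)) + norm ((1 - \<gamma>) *\<^sub>R T u)
      + norm ((\<gamma> * (1 - a)) *\<^sub>R T x)"
    by (simp only: norm_add_diff_le)
  also have "\<dots> \<le> \<gamma> * norm (T (u + x)) + (1 - \<gamma>) + \<gamma> * (1 - a)"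
    using \<gamma> a Tu Tx1 by (intro add_mono) (simp_all add: mult_left_le)
  finally have "\<gamma> * norm (T (u + x)) \<ge> 2 * \<gamma> - 8 * \<eta>"
    using lower a4 by linarith
  then have "norm (T (u + x)) \<ge> 2 - 8 * \<eta> / \<gamma>"
    using \<gamma> by (simp add: field_simps)
  with that[OF VO VT, of u N] uC vmax Vu show thesis by auto
qed

text \<open>On the blocks of \<open>D\<close>, where \<open>u\<close> and \<open>u'\<close> are unrelated, \<open>R\<close> writes a multiple of \<open>u\<close>, with a
  norming functional of \<open>u'\<close> as the factor. The norm does not grow because it is a supremum over
  the blocks.\<close>

lemma exists_contraction_onto:
  fixes u u' :: "'k::{real_normed_field, banach} c0_ell2"
  assumes u: "norm u \<le> 1" and u': "u' \<noteq> 0" "norm u' \<le> 1"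
    and eq: "c0_restrict (- D) u' = c0_restrict (- D) u"
  obtains R :: "'k c0_ell2 \<Rightarrow>\<^sub>L 'k c0_ell2" and g where
    "R \<in> operators c0_scale c0_scale" "\<And>z. norm (R z) \<le> norm z"
    "R (inverse (norm u') *\<^sub>R u') = u" "\<And>z. norm (g z) \<le> norm z"
    "\<And>z. R z = norm u' *\<^sub>R c0_restrict (- D) z + c0_scale (g z) (c0_restrict D u)"
proof -
  interpret X: banach_space_over "c0_scale :: 'k \<Rightarrow> 'k c0_ell2 \<Rightarrow> 'k c0_ell2"
    by (rule banach_space_over_c0_scale)
  obtain g :: "'k c0_ell2 \<Rightarrow> 'k" where g: "bounded_linear g" "\<And>c z. g (c0_scale c z) = c * g z"
    "\<And>z. norm (g z) \<le> norm z" "g u' = of_real (norm u')"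
    using c0_norming_functional[of u'] by blast
  let ?R = "\<lambda>z. norm u' *\<^sub>R c0_restrict (- D) z + c0_scale (g z) (c0_restrict D u)"
  have "bounded_linear ?R"
    by (intro bounded_linear_add bounded_linear_scaleR_right
        bounded_linear_compose[OF X.bounded_linear_scale_left g(1)]
        bounded_linear_compose[OF bounded_linear_scaleR_right bounded_linear_c0_restrict])
  define R where "R = Blinfun ?R"
  have R: "blinfun_apply R z = ?R z" for z
    unfolding R_def by (simp add: bounded_linear_Blinfun_apply[OF \<open>bounded_linear ?R\<close>])
  have "R \<in> operators c0_scale c0_scale"
    unfolding operators_def
    by (auto intro!: c0_eqI simp: R g(2) c0_restrict_scale block_simps algebra_simps)
  moreover have "norm (R z) \<le> norm z" for z
  proof (rule norm_c0_ell2_le)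
    fix k
    show "ell2_norm (Suc k) (block (R z) k) \<le> norm z"
    proof (cases "k \<in> D")
      case True
      have "norm (g z) * ell2_norm (Suc k) (block u k) \<le> norm z * 1"
        by (intro mult_mono g(3) order_trans[OF ell2_norm_block_le u]) auto
      with True show ?thesis
        by (simp add: R block_simps block_c0_restrict ell2_norm_scale)
    next
      case False
      have "norm u' * ell2_norm (Suc k) (block z k) \<le> 1 * norm z"
        by (intro mult_mono u'(2) ell2_norm_block_le) auto
      with False show ?thesis
        by (simp add: R block_simps block_c0_restrict scaleR_conv_of_real ell2_norm_scale)
    qed
  qed
  moreover have "R (inverse (norm u') *\<^sub>R u') = u"
  proof -
    have "R u' = norm u' *\<^sub>R u"
      unfolding R eq
      by (rule c0_eqI) (simp add: g(4) block_simps block_c0_restrict scaleR_conv_of_real)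
    then show ?thesis using u' by (simp add: blinfun.scaleR_right)
  qed
  ultimately show thesis using that g(3) R by blast
qed

text \<open>Where the blocks of \<open>w\<close> leave room to the unit sphere, \<open>w\<close> can be moved in both directions
  without leaving the ball, so uniform convexity of the range makes \<open>T\<close> small on those blocks,
  however many there are.\<close>

lemma operator_small_on_slack_blocks:
  fixes T :: "'k::real_normed_field c0_ell2 \<Rightarrow>\<^sub>L 'y::real_normed_vector"
  assumes uc: "\<And>a b :: 'y. norm a \<le> 1 \<Longrightarrow> norm b \<le> 1 \<Longrightarrow>
      norm ((1/2) *\<^sub>R (a + b)) > 1 - \<delta> \<Longrightarrow> norm (a - b) < 2 * \<rho> * r"
    and T: "norm T \<le> 1" and \<rho>: "\<rho> > 0"
    and w: "norm w \<le> 1" "norm (T w) > 1 - \<delta>"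
    and D: "D = {k. ell2_norm (Suc k) (block w k) \<le> 1 - \<rho>}"
  shows "norm (T (c0_restrict D z)) \<le> r * norm z"
proof -
  have unit: "norm (T (c0_restrict D z)) \<le> r" if "norm z \<le> 1" for z
  proof -
    have "norm (w + s *\<^sub>R c0_restrict D z) \<le> 1" if s: "\<bar>s\<bar> = \<rho>" for s
    proof (rule norm_c0_ell2_le)
      fix k
      show "ell2_norm (Suc k) (block (w + s *\<^sub>R c0_restrict D z) k) \<le> 1"
      proof (cases "k \<in> D")
        case True
        have "ell2_norm (Suc k) (block (w + s *\<^sub>R c0_restrict D z) k)
          \<le> ell2_norm (Suc k) (block w k) + \<bar>s\<bar> * ell2_norm (Suc k) (block z k)"
          using ell2_norm_triangle[of "Suc k" "block w k" "\<lambda>i. of_real s * block z k i"] True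
          by (simp add: block_simps block_c0_restrict scaleR_conv_of_real ell2_norm_scale)
        also have "\<dots> \<le> (1 - \<rho>) + \<rho> * 1"
          using True s \<rho> order_trans[OF ell2_norm_block_le \<open>norm z \<le> 1\<close>, of k]
          by (intro add_mono mult_mono) (auto simp: D)
        finally show ?thesis by simp
      next
        case False
        then show ?thesis
          using order_trans[OF ell2_norm_block_le w(1), of k]
          by (simp add: block_simps block_c0_restrict)
      qed
    qed
    from this[of \<rho>] this[of "- \<rho>"] have "norm (T (c0_restrict D z)) \<le> 2 * \<rho> * r / (2 * \<rho>)"
      using \<rho> w(2) by (intro uniformly_convex_image_small[OF uc T]) auto
    then show ?thesis using \<rho> by simp
  qed
  show ?thesis
  proof (cases "z = 0")
    case False
    have "c0_restrict D (inverse (norm z) *\<^sub>R z) = inverse (norm z) *\<^sub>R c0_restrict D z"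
      by (simp add: scaleR_c0_ell2_def c0_restrict_scale)
    with unit[of "inverse (norm z) *\<^sub>R z"] False show ?thesis
      by (simp add: blinfun.scaleR_right field_simps)
  qed (simp add: linear_simps(3)[OF bounded_linear_c0_restrict])
qed

text \<open>Outside \<open>D\<close> the contraction only multiplies by the number \<open>b\<close> near one, and whatever it does on
  \<open>D\<close> is hardly seen by \<open>T\<close>.\<close>

lemma operator_close_after_contraction:
  fixes T :: "'k::real_normed_field c0_ell2 \<Rightarrow>\<^sub>L 'y::banach"
    and R :: "'k c0_ell2 \<Rightarrow>\<^sub>L 'k c0_ell2"
  assumes Y: "banach_space_over scaleY" and TO: "T \<in> operators c0_scale scaleY"
    and T: "norm T \<le> 1" and small: "\<And>z. norm (T (c0_restrict D z)) \<le> r * norm z" and r: "0 \<le> r"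
    and u: "norm u \<le> 1" and b: "1 - r \<le> b" "b \<le> 1" and g: "norm (g z) \<le> norm z"
    and R: "R z = b *\<^sub>R c0_restrict (- D) z + c0_scale (g z) (c0_restrict D u)"
  shows "norm (T (R z) - T z) \<le> 3 * r * norm z"
proof -
  interpret Y: banach_space_over scaleY by (rule Y)
  have z: "z = c0_restrict (- D) z + c0_restrict D z"
    by (rule c0_eqI) (simp add: block_simps block_c0_restrict)
  have "T (R z) - T z = T (R z) - T (c0_restrict (- D) z + c0_restrict D z)"
    using z by simp
  also have "\<dots> = (b - 1) *\<^sub>R T (c0_restrict (- D) z)
      + scaleY (g z) (T (c0_restrict D u)) - T (c0_restrict D z)"
    by (simp add: R blinfun.bilinear_simps operatorsD[OF TO] algebra_simps)
  finally have "norm (T (R z) - T z) \<le> norm ((b - 1) *\<^sub>R T (c0_restrict (- D) z))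
      + norm (scaleY (g z) (T (c0_restrict D u))) + norm (T (c0_restrict D z))"
    by (simp only: norm_add_diff_le)
  also have "\<dots> \<le> r * norm z + norm z * r + r * norm z"
  proof (intro add_mono small)
    show "norm ((b - 1) *\<^sub>R T (c0_restrict (- D) z)) \<le> r * norm z"
      unfolding norm_scaleR
      by (intro mult_mono order_trans[OF norm_blinfun_le[OF T] norm_c0_restrict_le])
        (use b r in auto)
    have "norm (T (c0_restrict D u)) \<le> r"
      using order_trans[OF small mult_left_mono[OF u r]] by simp
    then show "norm (scaleY (g z) (T (c0_restrict D u))) \<le> norm z * r"
      unfolding Y.norm_scale by (intro mult_mono g) auto
  qed
  finally show ?thesis by simp
qed

lemma normalize_norm_attaining_operator:
  fixes T W :: "'x::real_normed_vector \<Rightarrow>\<^sub>L 'y::banach"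
  assumes Y: "banach_space_over scaleY" and WO: "W \<in> operators scaleX scaleY"
    and W: "norm (W u) = norm W" and T: "norm T = 1" and WT: "norm (W - T) \<le> t" and t: "t < 1"
  obtains S where "S \<in> operators scaleX scaleY" "norm S = 1" "norm (S u) = 1" "norm (S - T) \<le> 2 * t"
proof -
  interpret Y: banach_space_over scaleY by (rule Y)
  define s where "s = norm W"
  have s: "\<bar>1 - s\<bar> \<le> t"
    using norm_triangle_ineq3[of T W] WT T by (simp add: s_def norm_minus_commute)
  then have s0: "s > 0" using t by linarith
  define S where "S = inverse s *\<^sub>R W"
  have "S \<in> operators scaleX scaleY"
    unfolding operators_def S_def
    by (auto simp: blinfun.scaleR_left operatorsD[OF WO] Y.scale_of_real[symmetric] mult.commute)
  moreover have "norm S = 1" "norm (S u) = 1"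
    using W s0 by (simp_all add: S_def s_def blinfun.scaleR_left)
  moreover have "norm (S - T) \<le> 2 * t"
  proof -
    have "S - W = (inverse s - 1) *\<^sub>R W" by (simp add: S_def algebra_simps)
    then have "norm (S - W) = \<bar>inverse s - 1\<bar> * \<bar>s\<bar>" using s0 by (simp add: s_def)
    also have "\<dots> = \<bar>1 - s\<bar>" unfolding abs_mult[symmetric] using s0 by (simp add: algebra_simps)
    finally show ?thesis
      using norm_triangle_ineq[of "S - W" "W - T"] s WT by simp
  qed
  ultimately show thesis using that by blast
qed

section \<open>The Bishop-Phelps-Bollobas property\<close>

text \<open>This is the property for a fixed \<open>\<epsilon>\<close>. The maximum point \<open>u\<close> of the perturbation \<open>V\<close> need not
  be close to \<open>x\<close>, but it is so on every block outside \<open>D\<close>, and \<open>T\<close> hardly sees the blocks in \<open>D\<close>.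
  There \<open>u\<close> is replaced by \<open>x\<close>, and the contraction \<open>R\<close>, which undoes the replacement, carries the
  maximum of \<open>V\<close> over to \<open>V o\<^sub>L R\<close>.\<close>

lemma norm_attaining_approximation:
  fixes scaleY :: "'k::{real_normed_field, euclidean_space} \<Rightarrow> 'y::banach \<Rightarrow> 'y"
  assumes Y: "banach_space_over scaleY" and uc: "uniformly_convex TYPE('y)" and \<epsilon>: "\<epsilon> > 0"
  shows "\<exists>\<eta>>0. \<forall>T \<in> operators (c0_scale :: 'k \<Rightarrow> 'k c0_ell2 \<Rightarrow> 'k c0_ell2) scaleY. \<forall>x.
    norm T = 1 \<longrightarrow> norm x = 1 \<longrightarrow> norm (blinfun_apply T x) > 1 - \<eta> \<longrightarrow>
    (\<exists>u0. \<exists>S \<in> operators c0_scale scaleY. norm u0 = 1 \<and> norm S = 1 \<and>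
       norm (blinfun_apply S u0) = 1 \<and> norm (u0 - x) < \<epsilon> \<and> norm (S - T) < \<epsilon>)"
proof -
  define e where "e = min \<epsilon> 1"
  have e: "0 < e" "e \<le> 1" "e \<le> \<epsilon>" using \<epsilon> by (auto simp: e_def)
  define r where "r = e / 16"
  define \<rho> where "\<rho> = r\<^sup>2 / 8"
  have r: "0 < r" "r \<le> 1 / 16" using e by (simp_all add: r_def)
  have "r\<^sup>2 \<le> 1" using r by (simp add: power_le_one)
  then have \<rho>: "0 < \<rho>" "\<rho> \<le> 1 / 8" using r by (simp_all add: \<rho>_def)
  obtain \<delta> where \<delta>: "0 < \<delta>" and ucd: "\<And>a b :: 'y. norm a \<le> 1 \<Longrightarrow> norm b \<le> 1 \<Longrightarrow>
      norm ((1/2) *\<^sub>R (a + b)) > 1 - \<delta> \<Longrightarrow> norm (a - b) < 2 * \<rho> * r"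
    using uc \<rho> r unfolding uniformly_convex_def by (metis mult_pos_pos zero_less_numeral)
  \<comment> \<open>With this choice the lower bound \<open>2 - 8 * \<eta> / r\<close> for \<open>norm (T (u + x))\<close> becomes \<open>2 - \<delta>\<close>.\<close>
  define \<eta> where "\<eta> = r * \<delta> / 8"
  have \<eta>: "0 < \<eta>" using r \<delta> by (simp add: \<eta>_def)
  have "\<exists>u0. \<exists>S \<in> operators c0_scale scaleY. norm u0 = 1 \<and> norm S = 1 \<and>
      norm (blinfun_apply S u0) = 1 \<and> norm (u0 - x) < \<epsilon> \<and> norm (S - T) < \<epsilon>"
    if TO: "T \<in> operators c0_scale scaleY" and T: "norm T = 1" and x: "norm x = 1"
      and Tx: "norm (T x) > 1 - \<eta>"
    for T :: "'k c0_ell2 \<Rightarrow>\<^sub>L 'y" and x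
  proof -
    have T1: "norm T \<le> 1" using T by simp
    obtain V u N where VO: "V \<in> operators c0_scale scaleY" and VT: "norm (V - T) \<le> r"
      and u: "norm u \<le> 1" "c0_restrict {..<N} u = u"
      and vmax: "\<And>z. norm z \<le> 1 \<Longrightarrow> c0_restrict {..<N} z = z \<Longrightarrow> norm (V z) \<le> norm (V u)"
      and Tux: "norm (T (u + x)) \<ge> 2 - 8 * \<eta> / r"
      using exists_maximizing_perturbation[OF Y TO T1 x r(1) _ \<eta> Tx] r by auto
    define w where "w = (1/2) *\<^sub>R (u + x)"
    have Tw: "norm (T w) > 1 - \<delta>"
      using Tux r \<delta> by (simp add: w_def blinfun.scaleR_right \<eta>_def)
    have w1: "norm w \<le> 1"
      using norm_triangle_ineq[of u x] u x by (simp add: w_def)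
    define D where "D = {k. ell2_norm (Suc k) (block w k) \<le> 1 - \<rho>}"
    have small: "norm (T (c0_restrict D z)) \<le> r * norm z" for z
      by (rule operator_small_on_slack_blocks[OF ucd T1 \<rho>(1) w1 Tw D_def])
    have block_w: "ell2_norm (Suc k) (\<lambda>i. block u k i + block x k i)
        = 2 * ell2_norm (Suc k) (block w k)" for k
    proof -
      have "ell2_norm (Suc k) (block w k)
          = ell2_norm (Suc k) (\<lambda>i. of_real (1/2) * (block u k i + block x k i))"
        by (simp add: w_def block_simps scaleR_conv_of_real)
      then show ?thesis unfolding ell2_norm_scale by simp
    qed
    \<comment> \<open>Beyond \<open>N\<close> the blocks of \<open>w\<close> are those of \<open>x\<close> halved, so they lie in \<open>D\<close>; hence \<open>R\<close> below
      maps into the space on which \<open>u\<close> maximizes \<open>V\<close>.\<close>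
    have ge_N: "k \<in> D" if "k \<ge> N" for k
    proof -
      have "block u k = (\<lambda>i. 0)"
        using arg_cong[OF u(2), of "\<lambda>y. block y k"] that by (simp add: block_c0_restrict)
      then have "2 * ell2_norm (Suc k) (block w k) \<le> 1"
        using block_w[of k] ell2_norm_block_le[of k x] x by simp
      then show ?thesis using \<rho> by (simp add: D_def)
    qed
    have close: "ell2_norm (Suc k) (\<lambda>i. block u k i - block x k i) \<le> r" if "k \<notin> D" for k
    proof -
      have "ell2_norm (Suc k) (\<lambda>i. block u k i + block x k i) \<ge> 2 * (1 - r\<^sup>2 / 8)"
        using that block_w[of k] by (simp add: D_def \<rho>_def)
      then show ?thesis
        using ell2_norm_block_le[of k u] ell2_norm_block_le[of k x] u x r
        by (intro ell2_uniformly_convex) auto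
    qed
    define u' where "u' = c0_restrict (- D) u + c0_restrict D x"
    have u'x: "norm (u' - x) \<le> r"
      by (rule norm_c0_ell2_le)
        (use close r in \<open>auto simp: u'_def block_simps block_c0_restrict\<close>)
    have u'1: "norm u' \<le> 1"
      by (rule norm_c0_ell2_le)
        (use order_trans[OF ell2_norm_block_le u(1)] ell2_norm_block_le[of _ x] x in
          \<open>auto simp: u'_def block_simps block_c0_restrict\<close>)
    define b where "b = norm u'"
    have b: "1 - r \<le> b" "b \<le> 1" "b > 0"
      using norm_triangle_ineq2[of x u'] u'x u'1 x r by (auto simp: b_def norm_minus_commute)
    have u'0: "u' \<noteq> 0" using b by (auto simp: b_def)
    have u'u: "c0_restrict (- D) u' = c0_restrict (- D) u"
      by (rule c0_eqI) (simp add: u'_def block_simps block_c0_restrict)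
    obtain R g where RO: "R \<in> operators c0_scale c0_scale" and Rz: "\<And>z. norm (R z) \<le> norm z"
      and Ru: "R (inverse b *\<^sub>R u') = u" and g: "\<And>z :: 'k c0_ell2. norm (g z :: 'k) \<le> norm z"
      and R: "\<And>z. R z = b *\<^sub>R c0_restrict (- D) z + c0_scale (g z) (c0_restrict D u)"
      using exists_contraction_onto[OF u(1) u'0 u'1 u'u] unfolding b_def by blast
    define u0 where "u0 = inverse b *\<^sub>R u'"
    have u0: "norm u0 = 1" using b by (simp add: u0_def b_def[symmetric])
    have u0x: "norm (u0 - x) < \<epsilon>"
    proof -
      have "u0 - u' = (inverse b - 1) *\<^sub>R u'" by (simp add: u0_def algebra_simps)
      then have "norm (u0 - u') = \<bar>inverse b - 1\<bar> * b" by (simp add: b_def)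
      also have "\<dots> = 1 - b" using b by (simp add: abs_if field_simps)
      finally have "norm (u0 - x) \<le> (1 - b) + r"
        using norm_triangle_ineq[of "u0 - u'" "u' - x"] u'x by simp
      also have "\<dots> < \<epsilon>" using b e by (simp add: r_def)
      finally show ?thesis .
    qed
    define W where "W = V o\<^sub>L R"
    have WO: "W \<in> operators c0_scale scaleY"
      unfolding operators_def W_def by (simp add: operatorsD[OF RO] operatorsD[OF VO])
    have RN: "c0_restrict {..<N} (R z) = R z" for z
    proof (rule c0_eqI)
      fix k i
      show "block (c0_restrict {..<N} (R z)) k i = block (R z) k i"
        using ge_N[of k] arg_cong[OF u(2), of "\<lambda>y. block y k i"]
        by (auto simp: R block_simps block_c0_restrict)
    qed
    have Wu0: "W u0 = V u" by (simp add: W_def u0_def Ru)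
    have Wle: "norm (W z) \<le> norm (V u) * norm z" for z
    proof (cases "z = 0")
      case False
      have "norm (R (inverse (norm z) *\<^sub>R z)) \<le> 1"
        using Rz[of "inverse (norm z) *\<^sub>R z"] False by simp
      then have "norm (V (R (inverse (norm z) *\<^sub>R z))) \<le> norm (V u)"
        by (rule vmax[OF _ RN])
      then show ?thesis
        using False by (simp add: W_def blinfun.scaleR_right field_simps)
    qed simp
    have Wmax: "norm (W u0) = norm W"
    proof (rule antisym)
      show "norm (W u0) \<le> norm W" using norm_blinfun[of W u0] u0 by simp
      show "norm W \<le> norm (W u0)" unfolding Wu0 by (rule norm_blinfun_bound[OF _ Wle]) simp
    qed
    have WT: "norm (W - T) \<le> 4 * r"
    proof (rule norm_blinfun_bound)
      fix z :: "'k c0_ell2"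
      have "norm (T (R z) - T z) \<le> 3 * r * norm z"
        by (rule operator_close_after_contraction[OF Y TO T1 small _ u(1) b(1,2) g R])
          (use r in simp)
      moreover have "norm ((V - T) (R z)) \<le> r * norm z"
        by (rule order_trans[OF norm_blinfun mult_mono]) (use VT Rz r in auto)
      moreover have "(W - T) z = (V - T) (R z) + (T (R z) - T z)"
        by (simp add: W_def blinfun.diff_left)
      ultimately show "norm ((W - T) z) \<le> 4 * r * norm z"
        using norm_triangle_ineq[of "(V - T) (R z)" "T (R z) - T z"] by simp
    qed (use r in simp)
    obtain S where "S \<in> operators c0_scale scaleY" "norm S = 1" "norm (S u0) = 1"
      and "norm (S - T) \<le> 2 * (4 * r)"
      using normalize_norm_attaining_operator[OF Y WO Wmax T WT] r by auto
    moreover from this have "norm (S - T) < \<epsilon>" using e by (simp add: r_def)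
    ultimately show ?thesis using u0 u0x by blast
  qed
  with \<eta> show ?thesis by blast
qed

theorem BPBp_c0_ell2:
  fixes scaleY :: "'k::{real_normed_field, euclidean_space} \<Rightarrow> 'y::banach \<Rightarrow> 'y"
  assumes Y: "banach_space_over scaleY" and uc: "uniformly_convex TYPE('y)"
  shows "BPBp (c0_scale :: 'k \<Rightarrow> 'k c0_ell2 \<Rightarrow> 'k c0_ell2) scaleY"
proof -
  from norm_attaining_approximation[OF Y uc]
  obtain \<eta> where \<eta>: "\<And>\<epsilon>. \<epsilon> > 0 \<Longrightarrow> \<eta> \<epsilon> > 0 \<and>
    (\<forall>T \<in> operators (c0_scale :: 'k \<Rightarrow> 'k c0_ell2 \<Rightarrow> 'k c0_ell2) scaleY. \<forall>x.
      norm T = 1 \<longrightarrow> norm x = 1 \<longrightarrow> norm (blinfun_apply T x) > 1 - \<eta> \<epsilon> \<longrightarrow>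
      (\<exists>u0. \<exists>S \<in> operators c0_scale scaleY. norm u0 = 1 \<and> norm S = 1 \<and>
         norm (blinfun_apply S u0) = 1 \<and> norm (u0 - x) < \<epsilon> \<and> norm (S - T) < \<epsilon>))"
    by metis
  show ?thesis
    unfolding BPBp_def
    by (rule exI[of _ \<eta>], rule exI[of _ "\<lambda>\<epsilon>. \<epsilon>"])
      (intro conjI allI impI tendsto_ident_at; use \<eta> in simp)
qed

theorem theorem2p7:
  fixes scaleY :: "complex \<Rightarrow> 'yc::banach \<Rightarrow> 'yc"
  shows "(uniformly_convex TYPE('yr::banach) \<longrightarrow>
            BPBp (scaleR :: real \<Rightarrow> real c0_ell2 \<Rightarrow> real c0_ell2)
              (scaleR :: real \<Rightarrow> 'yr \<Rightarrow> 'yr)) \<and>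
         (banach_space_over scaleY \<and> uniformly_convex TYPE('yc) \<longrightarrow>
            BPBp (c0_scale :: complex \<Rightarrow> complex c0_ell2 \<Rightarrow> complex c0_ell2) scaleY)"
proof -
  have "(scaleR :: real \<Rightarrow> real c0_ell2 \<Rightarrow> real c0_ell2) = c0_scale"
    by (simp add: fun_eq_iff scaleR_c0_ell2_def)
  then show ?thesis
    using BPBp_c0_ell2[OF banach_space_over_scaleR, where ?'y = 'yr] BPBp_c0_ell2[of scaleY] by auto
qed

end
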